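(* For every $(a,b)\in\mathcal P_3$ the map $\Psi_{a,b}$ is simultaneously renormalizable in the family $\mathbb F=\{\Psi_{a,b}:(a,b)\in\mathcal P\}$ on the two different restrictive domains $\widetilde\Delta_{a,b}$ and $\Pi_{a,b}$, each with associated natural number $k=4$. Namely: (i) the restriction of $\Psi_{a,b}^4$ to $\widetilde\Delta_{a,b}$ is conjugate, by means of an affine change of coordinates, to $\Psi_{H_\Delta(a,b)}$ restricted to $\Psi_{H_\Delta(a,b)}(\mathcal T)$; (ii) the restriction of $\Psi_{a,b}^4$ to $\Pi_{a,b}$ is conjugate, by means of an affine change of coordinates, to $\Psi_{H_\Pi(a,b)}:\mathcal T\to\mathcal T$.
   Context: $\Omega(Q^1,\dots,Q^n)$ denotes the closed polygonal region in $\mathbb R^2$ with consecutive vertices $Q^1,\dots,Q^n$. Let $\mathcal T=\Omega((0,0),(1,1),(2,0))$ and $$\mathcal P=\{(a,b)\in(1,2]\times[1,2]:\ ab\le 2\}.$$ For $(a,b)\in\mathcal P$ the map $\Psi_{a,b}:\mathcal T\to\mathcal T$ is $$\Psi_{a,b}(x,y)=\begin{cases}(ax,ay), & x\le 1,\ x+y\le b,\\ (a(b-y),a(b-x)), & x\le 1,\ x+y\ge b,\\ (a(2-x),ay), & x\ge 1,\ x-y\ge 2-b,\\ (a(b-y),a(b-2+x)), & x\ge 1,\ x-y\le 2-b.\end{cases}$$ Put $\gamma_{a,b}=\dfrac{ab+b-2}{1+a-ab}$. The map $\Psi_{a,b}$ has a unique fixed point in the interior of $\mathcal T$, namely $$P_{a,b}=(x_{a,b},y_{a,b})=\left(\frac{ab+2a^2-a^2b}{1+a^2},\frac{ab-2a+a^2b}{1+a^2}\right),$$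 and $x_{a,b}>1$. Let $$\mathcal P_3=\left\{(a,b)\in\mathcal P:\ \frac{2+a^2+a^3}{1+a+a^3}\le b\le\frac{2(1+a+a^3)}{a(2+a^2+a^3)}\right\}=\{(a,b)\in\mathcal P:\ a^2\le\gamma_{a,b},\ a^3\gamma_{a,b}\le 2\}.$$ Use the affine coordinates $(X,Y)=\phi_{a,b}(x,y)=\left(\frac{x-x_{a,b}}{x_{a,b}-1},\frac{y-y_{a,b}}{x_{a,b}-1}\right)$. Define subsets of $\mathcal T$ by $$\Pi_{a,b}=\phi_{a,b}^{-1}\big(\Omega((0,0),(-2,0),(-1,-1))\big),$$ $$\widetilde\Delta_{a,b}=\phi_{a,b}^{-1}\Big(\Omega\big((0,0),\ (-\tfrac{a^2\gamma_{a,b}}2,\tfrac{a^2\gamma_{a,b}}2),\ (-a^4,\,a^2\gamma_{a,b}-a^4),\ (-a^4,0)\big)\Big).$$ The renormalization operators, which take values in $\mathcal P$, are $$H_\Delta(a,b)=\left(a^4,\frac{\gamma_{a,b}}{a^2}\right),\qquad H_\Pi(a,b)=\left(a^4,\frac{\gamma_{a,b}}{a}\right),\qquad (a,b)\in\mathcal P_3.$$ A set $\mathcal D\subsetneq\mathcal K$ is a restrictive domain for $\Gamma:\mathcal K\to\mathcal K$, with associated natural number $k$, if $\Gamma^j(\mathcal D)$ and $\mathcal D$ have disjoint interiors for $j=1,\dots,k-1$ and $\Gamma^k(\mathcal D)\subset\mathcal D$. "Renormalizable in $\mathbb F$" on these domains means that the conjugacies (i) and (ii) to maps of $\mathbb F$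 hold. *)

theory Defs
  imports "HOL-Analysis.Analysis"
begin

definition polygon_boundary :: "(real \<times> real) list \<Rightarrow> (real \<times> real) set" where
  "polygon_boundary vs =
     (\<Union>i<length vs. closed_segment (vs ! i) (vs ! (Suc i mod length vs)))"

text \<open>The constant \<^const>\<open>inside\<close> is the union of the bounded components of the complement. The order
  of the vertices matters; no convexity is assumed.\<close>
definition Omega :: "(real \<times> real) list \<Rightarrow> (real \<times> real) set" where
  "Omega vs = polygon_boundary vs \<union> inside (polygon_boundary vs)"

definition T :: "(real \<times> real) set" where
  "T = Omega [(0, 0), (1, 1), (2, 0)]"

definition P :: "(real \<times> real) set" where
  "P = {(a, b). 1 < a \<and> a \<le> 2 \<and> 1 \<le> b \<and> b \<le> 2 \<and> a * b \<le> 2}"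

text \<open>The four branches agree where their closed pieces overlap, so the order of the case
  distinction is immaterial. Only values on \<^const>\<open>T\<close> are meaningful.\<close>
definition Psi :: "real \<times> real \<Rightarrow> real \<times> real \<Rightarrow> real \<times> real" where
  "Psi = (\<lambda>(a, b) (x, y).
     if x \<le> 1 then
       (if x + y \<le> b then (a * x, a * y) else (a * (b - y), a * (b - x)))
     else
       (if x - y \<ge> 2 - b then (a * (2 - x), a * y) else (a * (b - y), a * (b - 2 + x))))"

definition gam :: "real \<times> real \<Rightarrow> real" where
  "gam = (\<lambda>(a, b). (a * b + b - 2) / (1 + a - a * b))"

text \<open>Closed form of the unique fixed point of \<open>Psi (a, b)\<close> in the interior of \<open>T\<close> for
  \<open>(a, b) \<in> P\<close>.\<close>
definition fixed_pt :: "real \<times> real \<Rightarrow> real \<times> real" where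
  "fixed_pt = (\<lambda>(a, b).
     ((a * b + 2 * a\<^sup>2 - a\<^sup>2 * b) / (1 + a\<^sup>2), (a * b - 2 * a + a\<^sup>2 * b) / (1 + a\<^sup>2)))"

definition P3 :: "(real \<times> real) set" where
  "P3 = {(a, b) \<in> P. (2 + a\<^sup>2 + a ^ 3) / (1 + a + a ^ 3) \<le> b
           \<and> b \<le> 2 * (1 + a + a ^ 3) / (a * (2 + a\<^sup>2 + a ^ 3))}"

lemma P3_alt: "P3 = {(a, b) \<in> P. a\<^sup>2 \<le> gam (a, b) \<and> a ^ 3 * gam (a, b) \<le> 2}"
proof -
  have "((2 + a\<^sup>2 + a ^ 3) / (1 + a + a ^ 3) \<le> b \<longleftrightarrow> a\<^sup>2 \<le> gam (a, b)) \<and>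
        (b \<le> 2 * (1 + a + a ^ 3) / (a * (2 + a\<^sup>2 + a ^ 3)) \<longleftrightarrow> a ^ 3 * gam (a, b) \<le> 2)"
    if "(a, b) \<in> P" for a b
  proof -
    have a: "1 < a" and "a * b \<le> 2"
      using that by (auto simp: P_def)
    then have d: "0 < 1 + a - a * b" by linarith
    have p: "0 < 1 + a + a ^ 3" "0 < a * (2 + a\<^sup>2 + a ^ 3)"
      using a by (auto intro!: add_pos_pos mult_pos_pos)
    have "a\<^sup>2 \<le> gam (a, b) \<longleftrightarrow> a\<^sup>2 * (1 + a - a * b) \<le> a * b + b - 2"
      using d by (simp add: gam_def pos_le_divide_eq)
    also have "\<dots> \<longleftrightarrow> 2 + a\<^sup>2 + a ^ 3 \<le> b * (1 + a + a ^ 3)"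
      by (simp add: algebra_simps power2_eq_square power3_eq_cube)
    also have "\<dots> \<longleftrightarrow> (2 + a\<^sup>2 + a ^ 3) / (1 + a + a ^ 3) \<le> b"
      using p(1) by (simp add: pos_divide_le_eq)
    finally have 1: "a\<^sup>2 \<le> gam (a, b) \<longleftrightarrow> (2 + a\<^sup>2 + a ^ 3) / (1 + a + a ^ 3) \<le> b" .
    have "a ^ 3 * gam (a, b) \<le> 2 \<longleftrightarrow> a ^ 3 * (a * b + b - 2) \<le> 2 * (1 + a - a * b)"
      using d by (simp add: gam_def pos_divide_le_eq)
    also have "\<dots> \<longleftrightarrow> b * (a * (2 + a\<^sup>2 + a ^ 3)) \<le> 2 * (1 + a + a ^ 3)"
      by (simp add: algebra_simps power2_eq_square power3_eq_cube)
    also have "\<dots> \<longleftrightarrow> b \<le> 2 * (1 + a + a ^ 3) / (a * (2 + a\<^sup>2 + a ^ 3))"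
      using p(2) by (simp only: pos_le_divide_eq)
    finally show ?thesis using 1 by blast
  qed
  then show ?thesis by (auto simp: P3_def)
qed

definition phi :: "real \<times> real \<Rightarrow> real \<times> real \<Rightarrow> real \<times> real" where
  "phi c = (\<lambda>(x, y). ((x - fst (fixed_pt c)) / (fst (fixed_pt c) - 1),
                      (y - snd (fixed_pt c)) / (fst (fixed_pt c) - 1)))"

definition Pi_dom :: "real \<times> real \<Rightarrow> (real \<times> real) set" where
  "Pi_dom c = phi c -` Omega [(0, 0), (-2, 0), (-1, -1)]"

definition Delta_dom :: "real \<times> real \<Rightarrow> (real \<times> real) set" where
  "Delta_dom = (\<lambda>(a, b). phi (a, b) -`
     Omega [(0, 0),
            (- (a\<^sup>2 * gam (a, b) / 2), a\<^sup>2 * gam (a, b) / 2),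
            (- (a ^ 4), a\<^sup>2 * gam (a, b) - a ^ 4),
            (- (a ^ 4), 0)])"

definition H_Delta :: "real \<times> real \<Rightarrow> real \<times> real" where
  "H_Delta = (\<lambda>(a, b). (a ^ 4, gam (a, b) / a\<^sup>2))"

definition H_Pi :: "real \<times> real \<Rightarrow> real \<times> real" where
  "H_Pi = (\<lambda>(a, b). (a ^ 4, gam (a, b) / a))"

definition restrictive_domain ::
  "'a::topological_space set \<Rightarrow> ('a \<Rightarrow> 'a) \<Rightarrow> nat \<Rightarrow> 'a set \<Rightarrow> bool" where
  "restrictive_domain K f k D \<longleftrightarrow>
     f ` K \<subseteq> K \<and> D \<subset> K \<and> 1 \<le> k \<and>
     (\<forall>j\<in>{1..k - 1}. interior ((f ^^ j) ` D) \<inter> interior D = {}) \<and>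
     (f ^^ k) ` D \<subseteq> D"

definition affine_coordinate_change :: "('a::real_vector \<Rightarrow> 'a) \<Rightarrow> bool" where
  "affine_coordinate_change h \<longleftrightarrow> (\<exists>L v. linear L \<and> bij L \<and> h = (\<lambda>p. L p + v))"

definition affinely_conjugate ::
  "('a::real_vector \<Rightarrow> 'a) \<Rightarrow> 'a set \<Rightarrow> ('a \<Rightarrow> 'a) \<Rightarrow> 'a set \<Rightarrow> bool" where
  "affinely_conjugate f D g E \<longleftrightarrow>
     f ` D \<subseteq> D \<and> g ` E \<subseteq> E \<and>
     (\<exists>h. affine_coordinate_change h \<and> h ` D = E \<and> (\<forall>p\<in>D. h (f p) = g (h p)))"

end

theory Submission
  imports Defs
begin

text \<open>
  Up to a homothety, \<^term>\<open>Psi (a, b)\<close> is a paper folding: fold \<^term>\<open>T\<close> along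
  its axis \<open>x = 1\<close>, fold the left half along the diagonal line \<open>x + y = b\<close>, and blow up by \<open>a\<close>
  (\<open>Psi_eq_fold\<close>). In the coordinates \<open>\<phi>\<close>, which put the fixed point at the origin and the axis at
  \<open>X = -1\<close>, the same map reads: fold along \<open>X = -1\<close>, then along the line \<open>X - Y = \<gamma>\<close>, then rotate by
  90 degrees about the origin and blow up by \<open>a\<close> (\<open>phi_Psi\<close>). Where neither fold acts the map is just
  the rotation with scaling, and four rotations by 90 degrees give the identity, so on a set where no
  fold acted \<open>\<Psi>\<^sup>4\<close> would be multiplication by \<open>a\<^sup>4\<close>.

  On each of the two domains at most two folds act during the four steps: the vertical one in the
  first step, and the diagonal one once. On \<open>\<Pi>\<close> the diagonal fold acts in the second step. Pulled
  back by one rotation with factor \<open>a\<close>, its line lies at \<open>x + y = \<gamma> / a\<close>, where \<open>(x, y) = (-X, -Y)\<close>.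
  On \<open>\<Delta>\<close> it acts in the third step, which puts the line at \<open>x + y = \<gamma> / a\<^sup>2\<close>, where
  \<open>(x, y) = (-X, Y)\<close>; one more rotation in the pull back accounts for the other sign of \<open>Y\<close>. In
  both cases \<open>\<Psi>\<^sup>4\<close> is \<open>a\<^sup>4\<close> times the two foldings that define \<open>\<Psi>\<close> with the parameters
  \<open>(a\<^sup>4, \<gamma> / a)\<close> or \<open>(a\<^sup>4, \<gamma> / a\<^sup>2)\<close>. The bounds \<open>a\<^sup>2 \<le> \<gamma>\<close> and \<open>a\<^sup>3 \<gamma> \<le> 2\<close> keep the orbit from crossing the
  creases in all other steps (\<open>orbit_of_Pi\<close>, \<open>orbit_of_Delta\<close>). Along the way the iterates visit different
  quadrants, which separates them from the domain by a line through the fixed point.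

  What is common to the two domains is collected in \<open>renormalization_if_orbits\<close>. The passage from
  vertex lists to inequalities rests on \<open>Omega_eq_half_planes\<close>.
\<close>

section \<open>Polygonal regions as intersections of half-planes\<close>

text \<open>For a bounded convex set, the inside of the frontier is the interior. So a polygonal region
  whose boundary is the frontier of an intersection of half-planes is that intersection. Because only
  the boundary as a set enters, repeated vertices do no harm.\<close>
lemma Omega_eq_half_planes:
  fixes H :: "((real \<times> real) \<times> real) set"
  defines "C \<equiv> {p. \<forall>(n, c)\<in>H. n \<bullet> p \<le> c}"
  assumes H: "finite H" "\<And>n c. (n, c) \<in> H \<Longrightarrow> n \<noteq> 0"
    and bdd: "bounded C"
    and edges: "polygon_boundary vs = {p \<in> C. \<exists>(n, c)\<in>H. n \<bullet> p = c}"
  shows "Omega vs = C"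
proof -
  have C_eq: "C = (\<Inter>h\<in>H. {p. fst h \<bullet> p \<le> snd h})"
    by (force simp: C_def)
  have "convex C" "closed C"
    by (auto simp: C_eq intro!: convex_INT convex_halfspace_le closed_INT closed_halfspace_le)
  have "interior C = (\<Inter>h\<in>H. interior {p. fst h \<bullet> p \<le> snd h})"
    unfolding C_eq using H(1) by (induction H rule: finite_induct) (auto simp: interior_Int)
  also have "\<dots> = {p. \<forall>(n, c)\<in>H. n \<bullet> p < c}"
    using H(2) by (fastforce simp: interior_halfspace_le)
  finally have "polygon_boundary vs = frontier C"
    using edges \<open>closed C\<close> by (fastforce simp: frontier_def C_def order.order_iff_strict)
  then have "Omega vs = frontier C \<union> interior C"
    using bdd \<open>convex C\<close> by (simp add: Omega_def inside_frontier_eq_interior)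
  then show ?thesis
    using \<open>closed C\<close> interior_subset[of C] by (auto simp: frontier_def)
qed

lemma closed_segment_graph:
  fixes x1 x2 m d :: real
  assumes "x1 \<le> x2" "y1 = m * x1 + d" "y2 = m * x2 + d"
  shows "closed_segment (x1, y1) (x2, y2) = {(x, y). x1 \<le> x \<and> x \<le> x2 \<and> y = m * x + d}"
proof -
  have "closed_segment (x1, y1) (x2, y2) = (\<lambda>x. (x, m * x + d)) ` closed_segment x1 x2"
    unfolding closed_segment_image_interval image_image assms(2,3)
    by (intro image_cong) (auto simp: algebra_simps)
  then show ?thesis
    using assms(1) by (auto simp: closed_segment_eq_real_ivl)
qed

lemma closed_segment_vertical:
  fixes x y1 y2 :: real
  assumes "y1 \<le> y2"
  shows "closed_segment (x, y1) (x, y2) = {(x', y). x' = x \<and> y1 \<le> y \<and> y \<le> y2}"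
proof -
  have "closed_segment (x, y1) (x, y2) = (\<lambda>y. (x, y)) ` closed_segment y1 y2"
    unfolding closed_segment_image_interval image_image
    by (intro image_cong) (auto simp: algebra_simps)
  then show ?thesis
    using assms by (auto simp: closed_segment_eq_real_ivl)
qed

lemma polygon_boundary_triangle:
  "polygon_boundary [p, q, r] = closed_segment p q \<union> closed_segment q r \<union> closed_segment r p"
  by (simp add: polygon_boundary_def lessThan_Suc Un_ac)

lemma polygon_boundary_quadrilateral:
  "polygon_boundary [p, q, r, s] =
     closed_segment p q \<union> closed_segment q r \<union> closed_segment r s \<union> closed_segment s p"
  by (simp add: polygon_boundary_def lessThan_Suc Un_ac)

lemma T_eq: "T = {(x, y). 0 \<le> y \<and> y \<le> x \<and> x + y \<le> 2}"
proof -
  let ?H = "{((0, -1), 0), ((-1, 1), 0), ((1, 1), 2)} :: ((real \<times> real) \<times> real) set"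
  have bdd: "bounded {p. \<forall>(n, c)\<in>?H. n \<bullet> p \<le> c}"
    by (rule bounded_subset[OF bounded_cbox[of "(0, 0)" "(2, 2)"]])
       (auto simp: cbox_Pair_eq)
  have "closed_segment (0, 0) (1, 1) = {(x, y). 0 \<le> x \<and> x \<le> 1 \<and> y = (x::real)}"
    by (subst closed_segment_graph[where m = 1 and d = 0]) auto
  moreover have "closed_segment (1, 1) (2, 0) = {(x, y). 1 \<le> x \<and> x \<le> 2 \<and> y = 2 - (x::real)}"
    by (subst closed_segment_graph[where m = "-1" and d = 2]) auto
  moreover have "closed_segment (2, 0) (0, 0) = {(x::real, y::real). 0 \<le> x \<and> x \<le> 2 \<and> y = 0}"
    by (subst closed_segment_commute, subst closed_segment_graph[where m = 0 and d = 0]) auto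
  ultimately have seg: "polygon_boundary [(0, 0), (1, 1), (2, 0)] =
      {(x, y). 0 \<le> x \<and> x \<le> 1 \<and> y = x \<or> 1 \<le> x \<and> x \<le> 2 \<and> y = 2 - x \<or>
               0 \<le> x \<and> x \<le> 2 \<and> y = 0}"
    unfolding polygon_boundary_triangle by blast
  have "polygon_boundary [(0, 0), (1, 1), (2, 0)] =
      {p \<in> {p. \<forall>(n, c)\<in>?H. n \<bullet> p \<le> c}. \<exists>(n, c)\<in>?H. n \<bullet> p = c}"
    unfolding seg by (intro set_eqI, clarsimp) (smt (verit))
  then have "T = {p. \<forall>(n, c)\<in>?H. n \<bullet> p \<le> c}"
    unfolding T_def using bdd by (intro Omega_eq_half_planes) (auto simp: zero_prod_def)
  also have "\<dots> = {(x, y). 0 \<le> y \<and> y \<le> x \<and> x + y \<le> 2}" by auto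
  finally show ?thesis .
qed

lemma Omega_Pi:
  "Omega [(0, 0), (-2, 0), (-1, -1)] = {(X, Y). (- X, - Y) \<in> T}"
proof -
  let ?H = "{((0, 1), 0), ((1, -1), 0), ((-1, -1), 2)} :: ((real \<times> real) \<times> real) set"
  have bdd: "bounded {p. \<forall>(n, c)\<in>?H. n \<bullet> p \<le> c}"
    by (rule bounded_subset[OF bounded_cbox[of "(-2, -2)" "(0, 0)"]])
       (auto simp: cbox_Pair_eq)
  have "closed_segment (0, 0) (-2, 0) = {(x::real, y::real). -2 \<le> x \<and> x \<le> 0 \<and> y = 0}"
    by (subst closed_segment_commute, subst closed_segment_graph[where m = 0 and d = 0]) auto
  moreover have "closed_segment (-2, 0) (-1, -1) =
      {(x, y). -2 \<le> x \<and> x \<le> -1 \<and> y = - 2 - (x::real)}"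
    by (subst closed_segment_graph[where m = "-1" and d = "-2"]) auto
  moreover have "closed_segment (-1, -1) (0, 0) = {(x, y). -1 \<le> x \<and> x \<le> 0 \<and> y = (x::real)}"
    by (subst closed_segment_graph[where m = 1 and d = 0]) auto
  ultimately have seg: "polygon_boundary [(0, 0), (-2, 0), (-1, -1)] =
      {(x, y). -2 \<le> x \<and> x \<le> 0 \<and> y = 0 \<or> -2 \<le> x \<and> x \<le> -1 \<and> y = - 2 - x \<or>
               -1 \<le> x \<and> x \<le> 0 \<and> y = x}"
    unfolding polygon_boundary_triangle by blast
  have "polygon_boundary [(0, 0), (-2, 0), (-1, -1)] =
      {p \<in> {p. \<forall>(n, c)\<in>?H. n \<bullet> p \<le> c}. \<exists>(n, c)\<in>?H. n \<bullet> p = c}"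
    unfolding seg by (intro set_eqI, clarsimp) (smt (verit))
  then have "Omega [(0, 0), (-2, 0), (-1, -1)] = {p. \<forall>(n, c)\<in>?H. n \<bullet> p \<le> c}"
    using bdd by (intro Omega_eq_half_planes) (auto simp: zero_prod_def)
  also have "\<dots> = {(X, Y). (- X, - Y) \<in> T}" by (auto simp: T_eq)
  finally show ?thesis .
qed

text \<open>For \<open>r = s\<close> the last two vertices coincide and the region is a triangle; this happens on the
  part \<open>\<gamma> = a\<^sup>2\<close> of the boundary of \<^term>\<open>P3\<close>.\<close>
lemma Omega_Delta:
  assumes "s / 2 \<le> r" "r \<le> s" "0 \<le> r"
  shows "Omega [(0, 0), (- (s / 2), s / 2), (- r, s - r), (- r, 0)] =
    {(X, Y). 0 \<le> Y \<and> Y \<le> - X \<and> - X \<le> r \<and> - X + Y \<le> s}"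
proof -
  let ?H = "{((0, -1), 0), ((1, 1), 0), ((-1, 0), r), ((-1, 1), s)} :: ((real \<times> real) \<times> real) set"
  have bdd: "bounded {p. \<forall>(n, c)\<in>?H. n \<bullet> p \<le> c}"
    by (rule bounded_subset[OF bounded_cbox[of "(-r, 0)" "(0, r)"]])
       (auto simp: cbox_Pair_eq)
  have "closed_segment (0, 0) (- (s / 2), s / 2) =
      {(x, y). - (s / 2) \<le> x \<and> x \<le> 0 \<and> y = - x}"
    using assms
    by (subst closed_segment_commute, subst closed_segment_graph[where m = "-1" and d = 0]) auto
  moreover have "closed_segment (- (s / 2), s / 2) (- r, s - r) =
      {(x, y). - r \<le> x \<and> x \<le> - (s / 2) \<and> y = x + s}"
    using assms
    by (subst closed_segment_commute, subst closed_segment_graph[where m = 1 and d = s]) auto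
  moreover have "closed_segment (- r, s - r) (- r, 0) = {(x, y). x = - r \<and> 0 \<le> y \<and> y \<le> s - r}"
    using assms by (subst closed_segment_commute, subst closed_segment_vertical) auto
  moreover have "closed_segment (- r, 0) (0, 0) = {(x, y). - r \<le> x \<and> x \<le> 0 \<and> y = (0::real)}"
    using assms by (subst closed_segment_graph[where m = 0 and d = 0]) auto
  ultimately have seg: "polygon_boundary [(0, 0), (- (s / 2), s / 2), (- r, s - r), (- r, 0)] =
      {(x, y). - (s / 2) \<le> x \<and> x \<le> 0 \<and> y = - x \<or>
               - r \<le> x \<and> x \<le> - (s / 2) \<and> y = x + s \<or>
               x = - r \<and> 0 \<le> y \<and> y \<le> s - r \<or>
               - r \<le> x \<and> x \<le> 0 \<and> y = 0}"
    unfolding polygon_boundary_quadrilateral by blast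
  have "polygon_boundary [(0, 0), (- (s / 2), s / 2), (- r, s - r), (- r, 0)] =
      {p \<in> {p. \<forall>(n, c)\<in>?H. n \<bullet> p \<le> c}. \<exists>(n, c)\<in>?H. n \<bullet> p = c}"
    unfolding seg using assms by (intro set_eqI, clarsimp) (smt (verit) field_sum_of_halves)
  then have "Omega [(0, 0), (- (s / 2), s / 2), (- r, s - r), (- r, 0)] =
      {p. \<forall>(n, c)\<in>?H. n \<bullet> p \<le> c}"
    using bdd by (intro Omega_eq_half_planes) (auto simp: zero_prod_def)
  also have "\<dots> = {(X, Y). 0 \<le> Y \<and> Y \<le> - X \<and> - X \<le> r \<and> - X + Y \<le> s}" by auto
  finally show ?thesis .
qed

section \<open>The maps as compositions of foldings\<close>

text \<open>The left half of \<^term>\<open>T\<close>, onto which the first fold maps it.\<close>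
definition half_T :: "(real \<times> real) set" where
  "half_T = {(x, y). 0 \<le> y \<and> y \<le> x \<and> x \<le> 1}"

definition fold_vertical :: "real \<times> real \<Rightarrow> real \<times> real" where
  "fold_vertical = (\<lambda>(x, y). (1 - \<bar>x - 1\<bar>, y))"

definition fold_diagonal :: "real \<Rightarrow> real \<times> real \<Rightarrow> real \<times> real" where
  "fold_diagonal b = (\<lambda>(x, y). if x + y \<le> b then (x, y) else (b - y, b - x))"

lemma Psi_eq_fold: "Psi (a, b) p = a *\<^sub>R fold_diagonal b (fold_vertical p)"
  by (cases p) (auto simp: Psi_def fold_diagonal_def fold_vertical_def abs_if algebra_simps)

lemma fold_vertical_in_half_T: "p \<in> T \<Longrightarrow> fold_vertical p \<in> half_T"
  by (auto simp: T_eq half_T_def fold_vertical_def abs_if)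

lemma half_T_subset_T: "half_T \<subseteq> T"
  by (auto simp: T_eq half_T_def)

text \<open>The part of the half triangle above the crease is reflected into the half triangle only because
  \<open>1 \<le> b\<close>: the corner \<open>(1, 1)\<close> goes to \<open>(b - 1, b - 1)\<close>.\<close>
lemma fold_diagonal_in_half_T:
  assumes "p \<in> half_T" "1 \<le> b"
  shows "fold_diagonal b p \<in> half_T \<inter> {(x, y). x + y \<le> b}"
  using assms by (cases p) (simp add: half_T_def fold_diagonal_def)

lemma Psi_image_T:
  assumes "0 < a" "1 \<le> b"
  shows "Psi (a, b) ` T = {(x, y). 0 \<le> y \<and> y \<le> x \<and> x \<le> a \<and> x + y \<le> a * b}"
proof (intro set_eqI iffI)
  fix p assume "p \<in> Psi (a, b) ` T"
  then obtain q where q: "q \<in> T" "p = Psi (a, b) q" by auto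
  obtain u v where uv: "fold_diagonal b (fold_vertical q) = (u, v)" by force
  have "p = (a * u, a * v)"
    using q(2) uv by (simp add: Psi_eq_fold)
  moreover have "(u, v) \<in> half_T" "u + v \<le> b"
    using fold_diagonal_in_half_T[OF fold_vertical_in_half_T[OF q(1)] assms(2)] uv by auto
  moreover from this(2) have "a * (u + v) \<le> a * b"
    using assms(1) by (intro mult_left_mono) auto
  ultimately show "p \<in> {(x, y). 0 \<le> y \<and> y \<le> x \<and> x \<le> a \<and> x + y \<le> a * b}"
    using assms(1) by (auto simp: half_T_def algebra_simps)
next
  fix p assume "p \<in> {(x, y). 0 \<le> y \<and> y \<le> x \<and> x \<le> a \<and> x + y \<le> a * b}"
  then obtain x y where p: "p = (x, y)" "0 \<le> y" "y \<le> x" "x \<le> a" "x + y \<le> a * b"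
    by auto
  have "(x / a, y / a) \<in> half_T" "x / a + y / a \<le> b"
    using p assms(1) by (auto simp: half_T_def field_simps)
  moreover from this have "Psi (a, b) (x / a, y / a) = p"
    using p(1) assms(1)
    by (auto simp: half_T_def Psi_eq_fold fold_diagonal_def fold_vertical_def)
  ultimately show "p \<in> Psi (a, b) ` T"
    using half_T_subset_T by (metis imageI subsetD)
qed

lemma Psi_maps_T:
  assumes "c \<in> P"
  shows "Psi c ` T \<subseteq> T"
proof -
  obtain a b where c: "c = (a, b)" by force
  show ?thesis
    using assms unfolding c by (subst Psi_image_T) (auto simp: P_def T_eq)
qed

text \<open>This is \<^term>\<open>Psi (a, b)\<close> in the coordinates \<^term>\<open>phi (a, b)\<close>, for \<open>g = gam (a, b)\<close>. Near the
  fixed point both folds of \<^const>\<open>Psi\<close> reflect, and two reflections make a rotation. Therefore the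
  side of the crease \<open>X - Y = g\<close> that is left alone here is the one that contains the origin, which is
  the side that \<^const>\<open>fold_diagonal\<close> reflects.\<close>
definition fold_rot :: "real \<Rightarrow> real \<Rightarrow> real \<times> real \<Rightarrow> real \<times> real" where
  "fold_rot a g = (\<lambda>(X, Y). let X' = \<bar>X + 1\<bar> - 1 in
     if X' - Y \<le> g then (- a * Y, a * X') else (- a * (X' - g), a * (Y + g)))"

lemma fold_rot_plain:
  "- 1 \<le> X \<Longrightarrow> X - Y \<le> g \<Longrightarrow> fold_rot a g (X, Y) = (- a * Y, a * X)"
  by (simp add: fold_rot_def)

section \<open>Coordinates centred at the fixed point\<close>

text \<open>The first two relations say that the branch of \<^term>\<open>Psi (a, b)\<close> with \<open>x \<ge> 1\<close> and
  \<open>x - y \<le> 2 - b\<close> fixes \<open>(x0, y0)\<close>. The fourth explains \<^const>\<open>gam\<close>: it locates the crease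
  \<open>x - y = 2 - b\<close> at \<open>X - Y = \<gamma>\<close>, in units of the distance \<open>x0 - 1\<close> to the axis.\<close>
lemma fixed_pt_relations:
  assumes "(a, b) \<in> P"
  defines "x0 \<equiv> fst (fixed_pt (a, b))" and "y0 \<equiv> snd (fixed_pt (a, b))"
  shows "x0 = a * (b - y0)" "y0 = a * (b - 2 + x0)"
    "0 < x0 - 1" "2 - b - x0 + y0 = gam (a, b) * (x0 - 1)" "0 < 2 - x0 - y0"
proof -
  have a: "1 < a" "1 \<le> b" "a * b \<le> 2"
    using assms(1) by (auto simp: P_def)
  have d: "0 < 1 + a - a * b"
    using a by linarith
  have p: "1 + a\<^sup>2 \<noteq> 0" "0 < 1 + a\<^sup>2"
    using zero_le_power2[of a] by linarith+
  show "x0 = a * (b - y0)" "y0 = a * (b - 2 + x0)"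
    using p(1) by (simp_all add: x0_def y0_def fixed_pt_def field_simps power2_eq_square)
  have "x0 + y0 = (2 * a\<^sup>2 - 2 * a + 2 * a * b) / (1 + a\<^sup>2)"
    unfolding x0_def y0_def fixed_pt_def by (simp add: add_divide_distrib[symmetric])
  moreover have "2 - \<dots> = 2 * (1 + a - a * b) / (1 + a\<^sup>2)"
    using p(1) by (simp add: field_simps)
  ultimately have "2 - x0 - y0 = 2 * (1 + a - a * b) / (1 + a\<^sup>2)"
    by linarith
  then show "0 < 2 - x0 - y0"
    using d p(2) by simp
  have s: "x0 - 1 = (a - 1) * (1 + a - a * b) / (1 + a\<^sup>2)"
    using p(1) by (simp add: x0_def fixed_pt_def field_simps power2_eq_square)
  show "0 < x0 - 1"
    using a(1) d p(2) unfolding s by (intro divide_pos_pos mult_pos_pos) auto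
  have "y0 - x0 = (2 * a\<^sup>2 * b - 2 * a - 2 * a\<^sup>2) / (1 + a\<^sup>2)"
    unfolding x0_def y0_def fixed_pt_def by (simp add: diff_divide_distrib[symmetric])
  moreover have "2 - b + \<dots> = (a - 1) * (a * b + b - 2) / (1 + a\<^sup>2)"
    using p(1) by (simp add: field_simps power2_eq_square)
  ultimately have "2 - b - x0 + y0 = (a - 1) * (a * b + b - 2) / (1 + a\<^sup>2)"
    by linarith
  then show "2 - b - x0 + y0 = gam (a, b) * (x0 - 1)"
    using d unfolding s by (simp add: gam_def)
qed

lemma phi_Psi:
  assumes "(a, b) \<in> P"
  shows "phi (a, b) (Psi (a, b) p) = fold_rot a (gam (a, b)) (phi (a, b) p)"
proof -
  obtain x y where p: "p = (x, y)" by force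
  define x0 y0 s t where "x0 = fst (fixed_pt (a, b))" and "y0 = snd (fixed_pt (a, b))"
    and "s = x0 - 1" and "t = \<bar>x - 1\<bar>"
  note rel = fixed_pt_relations[OF assms, folded x0_def y0_def, folded s_def]
  have s: "0 < s" and x0: "x0 = 1 + s"
    using rel(3) by (auto simp: s_def)
  have g: "gam (a, b) = (1 - b - s + y0) / s"
    using rel(4) s x0 by (simp add: field_simps)
  have X: "\<bar>(x - x0) / s + 1\<bar> - 1 = (t - s) / s"
  proof -
    have "(x - x0) / s + 1 = (x - 1) / s"
      using s by (simp add: x0 field_simps)
    then show ?thesis
      using s by (simp add: t_def abs_divide field_simps)
  qed
  have phi: "phi (a, b) (u, v) = ((u - x0) / s, (v - y0) / s)" for u v
    by (simp add: phi_def x0_def y0_def s_def)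
  \<comment> \<open>The two creases coincide, but the sides on which the two maps reflect are opposite.\<close>
  have cond: "(t - s) / s - (y - y0) / s \<le> gam (a, b) \<longleftrightarrow> b \<le> 1 - t + y"
    using s unfolding g diff_divide_distrib[symmetric] by (simp add: divide_le_cancel) linarith
  have Psi: "Psi (a, b) p =
      (if b \<le> 1 - t + y then (a * (b - y), a * (b - (1 - t))) else (a * (1 - t), a * y))"
    by (auto simp: p Psi_eq_fold fold_diagonal_def fold_vertical_def t_def)
  have e: "a * (b - y) - x0 = - a * (y - y0)"
    and f: "a * (1 - t) - x0 = - a * (t - s - (1 - b - s + y0))"
    using rel(1) by (simp_all add: algebra_simps)
  have e': "a * (b - (1 - t)) - y0 = a * (t - s)"
    and f': "a * y - y0 = a * (y - y0 + (1 - b - s + y0))"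
    using rel(2) unfolding x0 by (simp_all add: algebra_simps)
  show ?thesis
  proof (cases "b \<le> 1 - t + y")
    case True
    then have "phi (a, b) (Psi (a, b) p) = (- a * (y - y0) / s, a * (t - s) / s)"
      unfolding Psi using e e' by (simp add: phi)
    also have "\<dots> = fold_rot a (gam (a, b)) (phi (a, b) p)"
      using True unfolding p phi fold_rot_def by (simp add: X cond Let_def)
    finally show ?thesis .
  next
    case False
    then have "phi (a, b) (Psi (a, b) p) =
        (- a * (t - s - (1 - b - s + y0)) / s, a * (y - y0 + (1 - b - s + y0)) / s)"
      unfolding Psi using f f' by (simp add: phi)
    also have "\<dots> = (- a * ((t - s) / s - gam (a, b)), a * ((y - y0) / s + gam (a, b)))"
      unfolding g using s by (simp add: field_simps)
    also have "\<dots> = fold_rot a (gam (a, b)) (phi (a, b) p)"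
      using False unfolding p phi fold_rot_def by (simp add: X cond Let_def)
    finally show ?thesis .
  qed
qed

lemma phi_funpow_Psi:
  assumes "(a, b) \<in> P"
  shows "phi (a, b) ((Psi (a, b) ^^ n) p) = (fold_rot a (gam (a, b)) ^^ n) (phi (a, b) p)"
  by (induction n) (simp_all add: phi_Psi[OF assms])

text \<open>Sets on different sides of a line meet at most in that line, which has empty interior.\<close>
lemma interiors_disjoint_if_separated:
  fixes A D :: "(real \<times> real) set"
  assumes "(a, b) \<in> P" "n \<noteq> 0"
    and A: "\<And>p. p \<in> A \<Longrightarrow> 0 \<le> n \<bullet> phi (a, b) p"
    and D: "\<And>p. p \<in> D \<Longrightarrow> n \<bullet> phi (a, b) p \<le> 0"
  shows "interior A \<inter> interior D = {}"
proof -
  define z where "z = fixed_pt (a, b)"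
  have s: "0 < fst z - 1"
    using fixed_pt_relations(3)[OF assms(1)] by (simp add: z_def)
  have phi: "phi (a, b) p = (1 / (fst z - 1)) *\<^sub>R (p - z)" for p
    by (cases p; cases z) (simp add: phi_def z_def)
  have "A \<inter> D \<subseteq> {p. n \<bullet> p = n \<bullet> z}"
  proof clarify
    fix p assume "p \<in> A" "p \<in> D"
    then have "n \<bullet> phi (a, b) p = 0"
      using A[of p] D[of p] by simp
    then show "n \<bullet> p = n \<bullet> z"
      using s by (simp add: phi inner_diff_right)
  qed
  then have "interior (A \<inter> D) \<subseteq> interior {p. n \<bullet> p = n \<bullet> z}"
    by (rule interior_mono)
  then show ?thesis
    using \<open>n \<noteq> 0\<close> by (simp add: interior_Int interior_hyperplane)
qed

text \<open>The fixed point is so far from the sides of \<^term>\<open>T\<close> that both domains fit into the region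
  described here; it is chosen to cover them at once.\<close>
lemma phi_in_T:
  assumes "(a, b) \<in> P" "0 \<le> gam (a, b)"
    and XY: "phi (a, b) p = (X, Y)" "- 1 \<le> Y" "X + Y \<le> 0" "Y - X \<le> 2"
  shows "p \<in> T"
proof -
  obtain x y where p: "p = (x, y)" by force
  define x0 y0 s where "x0 = fst (fixed_pt (a, b))" and "y0 = snd (fixed_pt (a, b))"
    and "s = x0 - 1"
  note rel = fixed_pt_relations[OF assms(1), folded x0_def y0_def, folded s_def]
  have s: "0 < s" and x0: "x0 = 1 + s"
    using rel(3) by (auto simp: s_def)
  have xy: "x = x0 + s * X" "y = y0 + s * Y"
    using XY(1) s by (auto simp: p phi_def x0_def y0_def s_def)
  have "s \<le> y0"
    using rel(4) mult_nonneg_nonneg[OF assms(2) order.strict_implies_order[OF s]] assms(1)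
    by (auto simp: P_def x0)
  moreover have "s * (- 1) \<le> s * Y"
    using s XY(2) by (intro mult_left_mono) auto
  moreover have "s * (X + Y) \<le> s * 0"
    using s XY(3) by (intro mult_left_mono) auto
  moreover have "s * (Y - X) \<le> s * 2"
    using s XY(4) by (intro mult_left_mono) auto
  ultimately show ?thesis
    using rel(5) unfolding T_eq p xy x0 by (auto simp: algebra_simps)
qed

text \<open>The coordinates of the conjugacy are \<open>\<phi>\<close> followed by the involution \<open>J\<close>, which turns the
  wedge at the fixed point that contains the domain into the wedge at the corner \<open>(0, 0)\<close> that contains
  \<^term>\<open>T\<close>. For \<open>\<sigma> = -1\<close> it is the half turn, used on \<open>\<Pi>\<close>; for \<open>\<sigma> = 1\<close> it is the reflection in the
  \<open>Y\<close>-axis, used on \<open>\<Delta>\<close>. Everything then follows from a description of the orbits of \<open>J q\<close> under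
  \<^const>\<open>fold_rot\<close> for \<open>q \<in> E\<close>: the fourth point has to be \<open>J (G q)\<close>, and a line through the fixed point
  has to separate each earlier one from the domain.\<close>
lemma renormalization_if_orbits:
  fixes \<sigma> :: real and E :: "(real \<times> real) set"
  defines "J \<equiv> (\<lambda>p::real \<times> real. (- fst p, \<sigma> * snd p))"
  assumes P: "(a, b) \<in> P" "0 \<le> gam (a, b)" and \<sigma>: "\<sigma> = 1 \<or> \<sigma> = - 1"
    and D: "D = {p. J (phi (a, b) p) \<in> E}"
    and E: "E \<subseteq> T" "G ` E \<subseteq> E"
    and return: "\<And>q. q \<in> E \<Longrightarrow> (fold_rot a (gam (a, b)) ^^ 4) (J q) = J (G q)"
    and separated: "\<And>j. j \<in> {1, 2, 3} \<Longrightarrow> \<exists>n. n \<noteq> 0 \<and>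
      (\<forall>q\<in>E. n \<bullet> J q \<le> 0 \<and> 0 \<le> n \<bullet> (fold_rot a (gam (a, b)) ^^ j) (J q))"
  shows "restrictive_domain T (Psi (a, b)) 4 D \<and> affinely_conjugate (Psi (a, b) ^^ 4) D G E"
proof -
  define h where "h = (\<lambda>p. J (phi (a, b) p))"
  define x0 y0 s where "x0 = fst (fixed_pt (a, b))" and "y0 = snd (fixed_pt (a, b))"
    and "s = x0 - 1"
  note rel = fixed_pt_relations[OF P(1), folded x0_def y0_def, folded s_def]
  have s: "0 < s"
    using rel(3) .
  have phi: "phi (a, b) p = ((fst p - x0) / s, (snd p - y0) / s)" for p
    by (cases p) (simp add: phi_def x0_def y0_def s_def)
  have JJ: "J (J q) = q" for q
    using \<sigma> by (auto simp: J_def)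
  then have phi_eq: "phi (a, b) p = J (h p)" for p
    by (simp add: h_def)
  have D_h: "D = h -` E"
    by (auto simp: D h_def)
  define L :: "real \<times> real \<Rightarrow> real \<times> real" where "L = (\<lambda>p. (- fst p / s, \<sigma> * snd p / s))"
  have "linear L"
    by (rule linearI) (auto simp: L_def add_divide_distrib algebra_simps)
  moreover have bij_L: "bij L"
  proof (rule o_bij)
    have "\<sigma> * \<sigma> = 1"
      using \<sigma> by auto
    then show "(\<lambda>p. (- s * fst p, \<sigma> * s * snd p)) \<circ> L = id" "L \<circ> (\<lambda>p. (- s * fst p, \<sigma> * s * snd p)) = id"
      using s by (simp_all add: L_def fun_eq_iff)
  qed
  moreover have h_L: "h = (\<lambda>p. L p + (x0 / s, - \<sigma> * y0 / s))"
    by (simp add: fun_eq_iff h_def J_def L_def phi diff_divide_distrib right_diff_distrib)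
  ultimately have affine: "affine_coordinate_change h"
    unfolding affine_coordinate_change_def by blast
  have "surj h"
    unfolding h_L surj_def using bij_is_surj[OF bij_L, unfolded surj_def]
    by (metis diff_add_cancel)
  then have image: "h ` D = E"
    by (simp add: D_h)
  have conj: "h ((Psi (a, b) ^^ 4) p) = G (h p)" if "p \<in> D" for p
  proof -
    have "h ((Psi (a, b) ^^ 4) p) = J ((fold_rot a (gam (a, b)) ^^ 4) (J (h p)))"
      by (simp add: h_def JJ phi_funpow_Psi[OF P(1)])
    also have "\<dots> = G (h p)"
      using that by (simp add: D_h return JJ)
    finally show ?thesis .
  qed
  have inv: "(Psi (a, b) ^^ 4) ` D \<subseteq> D"
    using conj E(2) by (auto simp: D_h)
  have T_ineqs: "0 \<le> y" "y \<le> x" "x + y \<le> 2" "y \<le> 1" if "(x, y) \<in> E" for x y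
    using that E(1) by (auto simp: T_eq)
  have "D \<subseteq> T"
  proof
    fix p assume "p \<in> D"
    then obtain x y where xy: "h p = (x, y)" "(x, y) \<in> E"
      by (cases "h p") (auto simp: D_h)
    then have "phi (a, b) p = (- x, \<sigma> * y)"
      by (simp add: phi_eq J_def)
    then show "p \<in> T"
      using \<sigma> T_ineqs[OF xy(2)] by (intro phi_in_T[OF P]) auto
  qed
  \<comment> \<open>The domain lies on or below the line \<open>X + Y = 0\<close>, the corner \<open>(2, 0)\<close> strictly above it.\<close>
  moreover have "(2, 0) \<in> T" "(2, 0) \<notin> D"
  proof -
    show "(2, 0) \<in> T" by (simp add: T_eq)
    show "(2, 0) \<notin> D"
    proof
      assume "(2, 0) \<in> D"
      then have "(- ((2 - x0) / s), \<sigma> * (- y0 / s)) \<in> E"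
        by (simp add: D_h h_def J_def phi)
      then have "0 \<le> \<sigma> * (- y0 / s)" "\<sigma> * (- y0 / s) \<le> - ((2 - x0) / s)"
        by (fact T_ineqs)+
      then have "(2 - x0) / s \<le> y0 / s"
        using \<sigma> by auto
      then show False
        using rel(5) s by (simp add: divide_le_cancel)
    qed
  qed
  ultimately have "D \<subset> T" by blast
  moreover have "interior ((Psi (a, b) ^^ j) ` D) \<inter> interior D = {}" if j: "j \<in> {1, 2, 3}" for j
  proof -
    obtain n where n: "n \<noteq> 0" "\<And>q. q \<in> E \<Longrightarrow> n \<bullet> J q \<le> 0"
      "\<And>q. q \<in> E \<Longrightarrow> 0 \<le> n \<bullet> (fold_rot a (gam (a, b)) ^^ j) (J q)"
      using separated[OF j] by blast
    show ?thesis
    proof (rule interiors_disjoint_if_separated[OF P(1) n(1)])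
      fix p assume "p \<in> (Psi (a, b) ^^ j) ` D"
      then obtain q where "h q \<in> E" "p = (Psi (a, b) ^^ j) q"
        unfolding D_h by blast
      then show "0 \<le> n \<bullet> phi (a, b) p"
        using n(3)[of "h q"] by (simp only: phi_funpow_Psi[OF P(1)] phi_eq[of q])
    next
      fix p assume "p \<in> D"
      then show "n \<bullet> phi (a, b) p \<le> 0"
        using n(2)[of "h p"] by (simp add: D_h phi_eq[of p])
    qed
  qed
  moreover have "{1..4 - 1} = {1, 2, 3::nat}" by auto
  ultimately show ?thesis
    using inv E(2) affine image conj Psi_maps_T[OF P(1)]
    unfolding restrictive_domain_def affinely_conjugate_def by auto
qed

section \<open>The orbits of the two domains\<close>

text \<open>The points \<open>(w, y)\<close> and \<open>(u, v)\<close> are the images of \<open>(x, y)\<close> under the first fold and under both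
  folds of the renormalized map. The diagonal fold acts in the second step, before which the points
  have been turned once and blown up by \<open>a\<close>; hence its parameter \<open>g / a\<close>. In the third step
  \<open>a\<^sup>2 \<le> g\<close> keeps the orbit off the diagonal crease, and in the fourth \<open>a\<^sup>3 g \<le> 2\<close> keeps it off the
  vertical one.\<close>
lemma orbit_of_Pi:
  fixes a g :: real
  assumes a: "1 < a" "a\<^sup>2 \<le> g" "a ^ 3 * g \<le> 2" and T: "(x, y) \<in> T"
    and uv: "fold_diagonal (g / a) (fold_vertical (x, y)) = (u, v)"
  defines "w \<equiv> 1 - \<bar>x - 1\<bar>"
  shows "fold_rot a g (- x, - y) = (a * y, - (a * w))"
    "fold_rot a g (a * y, - (a * w)) = (a\<^sup>2 * u, a\<^sup>2 * v)"
    "fold_rot a g (a\<^sup>2 * u, a\<^sup>2 * v) = (- (a ^ 3 * v), a ^ 3 * u)"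
    "fold_rot a g (- (a ^ 3 * v), a ^ 3 * u) = (- (a ^ 4 * u), - (a ^ 4 * v))"
    "0 \<le> y" "0 \<le> u" "0 \<le> v"
proof -
  have "a \<le> a\<^sup>2"
    using a(1) by (simp add: power2_eq_square)
  then have g: "a \<le> g" "0 \<le> g" using a by auto
  have ge1: "1 \<le> g / a"
    using g a(1) by simp
  then have ineqs: "0 \<le> y" "y \<le> w" "0 \<le> v" "v \<le> u" "u \<le> 1" "u + v \<le> g / a"
    using fold_diagonal_in_half_T[OF fold_vertical_in_half_T[OF T] ge1]
      fold_vertical_in_half_T[OF T] uv
    by (auto simp: half_T_def fold_vertical_def w_def)
  show "0 \<le> y" "0 \<le> u" "0 \<le> v"
    using ineqs by auto
  have "\<bar>- x + 1\<bar> - 1 = - w"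
    by (simp add: w_def abs_if)
  then show "fold_rot a g (- x, - y) = (a * y, - (a * w))"
    using ineqs g by (simp add: fold_rot_def)
  define B where "B = g / a"
  have g_eq: "g = a * B"
    using a(1) by (simp add: B_def)
  have y: "\<bar>a * y + 1\<bar> - 1 = a * y"
    using ineqs a(1) by simp
  have crease: "a * y - - (a * w) \<le> g \<longleftrightarrow> w + y \<le> B"
    using a(1) unfolding g_eq by (simp add: add.commute flip: distrib_left)
  have u: "u = (if w + y \<le> B then w else B - y)" and v: "v = (if w + y \<le> B then y else B - w)"
    using uv by (auto simp: fold_diagonal_def fold_vertical_def w_def B_def split: if_splits)
  have "fold_rot a g (a * y, - (a * w)) =
      (if w + y \<le> B then (- a * - (a * w), a * (a * y))
       else (- a * (a * y - g), a * (- (a * w) + g)))"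
    by (simp only: fold_rot_def prod.case Let_def y crease)
  also have "\<dots> = (a\<^sup>2 * u, a\<^sup>2 * v)"
    unfolding u v by (simp add: g_eq algebra_simps power2_eq_square)
  finally show "fold_rot a g (a * y, - (a * w)) = (a\<^sup>2 * u, a\<^sup>2 * v)" .
  have "a\<^sup>2 * (u - v) \<le> a\<^sup>2 * 1"
    using ineqs by (intro mult_left_mono) auto
  moreover have "0 \<le> a\<^sup>2 * u"
    using ineqs by simp
  ultimately show "fold_rot a g (a\<^sup>2 * u, a\<^sup>2 * v) = (- (a ^ 3 * v), a ^ 3 * u)"
    using a by (subst fold_rot_plain)
      (auto simp: algebra_simps power2_eq_square power3_eq_cube)
  \<comment> \<open>From \<open>v \<le> u\<close> and \<open>u + v \<le> g / a\<close>; then \<open>a\<^sup>3 v \<le> 1\<close> means that the vertical crease is not crossed.\<close>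
  have "a ^ 3 * (2 * v) \<le> a ^ 3 * (g / a)"
    using ineqs a by (intro mult_left_mono) auto
  also have "\<dots> = a\<^sup>2 * g"
    using a by (simp add: power2_eq_square power3_eq_cube)
  also have "\<dots> \<le> a ^ 3 * g"
    using a g by (intro mult_right_mono power_increasing) auto
  finally have "a ^ 3 * v \<le> 1"
    using a(3) by simp
  moreover have "0 \<le> a ^ 3 * u" "0 \<le> a ^ 3 * v"
    using ineqs a by auto
  ultimately show "fold_rot a g (- (a ^ 3 * v), a ^ 3 * u) = (- (a ^ 4 * u), - (a ^ 4 * v))"
    using g by (subst fold_rot_plain) (auto simp: eval_nat_numeral)
qed

text \<open>Compared with \<open>\<Pi>\<close>, the diagonal fold comes one step later, hence its parameter \<open>g / a\<^sup>2\<close>. The bound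
  \<open>x + y \<le> a\<^sup>2 g\<close> holds on the image of the renormalized map. The apex \<open>(1, 1)\<close> of \<^term>\<open>T\<close> violates
  it and would be folded vertically again in the second step; this is why the conjugacy on \<open>\<Delta>\<close>
  concerns only that image.\<close>
lemma orbit_of_Delta:
  fixes a g :: real
  assumes a: "1 < a" "a\<^sup>2 \<le> g" "a ^ 3 * g \<le> 2"
    and T: "(x, y) \<in> T" and xy: "x + y \<le> a\<^sup>2 * g"
    and uv: "fold_diagonal (g / a\<^sup>2) (fold_vertical (x, y)) = (u, v)"
  defines "w \<equiv> 1 - \<bar>x - 1\<bar>"
  shows "fold_rot a g (- x, y) = (- (a * y), - (a * w))"
    "fold_rot a g (- (a * y), - (a * w)) = (a\<^sup>2 * w, - (a\<^sup>2 * y))"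
    "fold_rot a g (a\<^sup>2 * w, - (a\<^sup>2 * y)) = (a ^ 3 * v, a ^ 3 * u)"
    "fold_rot a g (a ^ 3 * v, a ^ 3 * u) = (- (a ^ 4 * u), a ^ 4 * v)"
    "0 \<le> y" "0 \<le> w" "0 \<le> v"
proof -
  have "a \<le> a\<^sup>2"
    using a(1) by (simp add: power2_eq_square)
  then have g: "a \<le> g" "0 \<le> g" using a by auto
  have ge1: "1 \<le> g / a\<^sup>2"
    using a by simp
  then have ineqs: "0 \<le> y" "y \<le> w" "w \<le> 1" "0 \<le> v" "v \<le> u" "u \<le> 1" "y \<le> x"
    using fold_diagonal_in_half_T[OF fold_vertical_in_half_T[OF T] ge1]
      fold_vertical_in_half_T[OF T] uv T
    by (auto simp: half_T_def fold_vertical_def w_def T_eq)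
  show "0 \<le> y" "0 \<le> w" "0 \<le> v"
    using ineqs by auto
  have "\<bar>- x + 1\<bar> - 1 = - w"
    by (simp add: w_def abs_if)
  then show "fold_rot a g (- x, y) = (- (a * y), - (a * w))"
    using ineqs g by (simp add: fold_rot_def)
  \<comment> \<open>From \<open>y \<le> x\<close> and \<open>x + y \<le> a\<^sup>2 g\<close>; then \<open>a y \<le> 1\<close> means that the vertical crease is not crossed.\<close>
  have "a * (2 * y) \<le> a * (a\<^sup>2 * g)"
    using ineqs xy a by (intro mult_left_mono) auto
  also have "\<dots> = a ^ 3 * g"
    by (simp add: eval_nat_numeral)
  finally have "a * y \<le> 1"
    using a(3) by simp
  moreover have "a * w \<le> a * 1" "0 \<le> a * y"
    using ineqs a by (auto intro: mult_left_mono)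
  ultimately show "fold_rot a g (- (a * y), - (a * w)) = (a\<^sup>2 * w, - (a\<^sup>2 * y))"
    using g by (subst fold_rot_plain) (auto simp: power2_eq_square)
  define B where "B = g / a\<^sup>2"
  have g_eq: "g = a\<^sup>2 * B"
    using a(1) by (simp add: B_def)
  have w: "\<bar>a\<^sup>2 * w + 1\<bar> - 1 = a\<^sup>2 * w"
    using ineqs by simp
  have crease: "a\<^sup>2 * w - - (a\<^sup>2 * y) \<le> g \<longleftrightarrow> w + y \<le> B"
    using a(1) unfolding g_eq by (simp flip: distrib_left)
  have u: "u = (if w + y \<le> B then w else B - y)" and v: "v = (if w + y \<le> B then y else B - w)"
    using uv by (auto simp: fold_diagonal_def fold_vertical_def w_def B_def split: if_splits)
  have "fold_rot a g (a\<^sup>2 * w, - (a\<^sup>2 * y)) =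
      (if w + y \<le> B then (- a * - (a\<^sup>2 * y), a * (a\<^sup>2 * w))
       else (- a * (a\<^sup>2 * w - g), a * (- (a\<^sup>2 * y) + g)))"
    by (simp only: fold_rot_def prod.case Let_def w crease)
  also have "\<dots> = (a ^ 3 * v, a ^ 3 * u)"
    unfolding u v by (simp add: g_eq algebra_simps power2_eq_square power3_eq_cube)
  finally show "fold_rot a g (a\<^sup>2 * w, - (a\<^sup>2 * y)) = (a ^ 3 * v, a ^ 3 * u)" .
  have "0 \<le> a ^ 3 * v" "a ^ 3 * v \<le> a ^ 3 * u"
    using ineqs a by auto
  then show "fold_rot a g (a ^ 3 * v, a ^ 3 * u) = (- (a ^ 4 * u), a ^ 4 * v)"
    using g by (subst fold_rot_plain) (auto simp: eval_nat_numeral)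
qed

section \<open>Simultaneous renormalization\<close>

lemma P3_bounds:
  assumes "(a, b) \<in> P3"
  shows "(a, b) \<in> P" "1 < a" "a\<^sup>2 \<le> gam (a, b)" "a ^ 3 * gam (a, b) \<le> 2"
    "0 \<le> gam (a, b)" "a\<^sup>2 * gam (a, b) \<le> 2"
proof -
  show *: "(a, b) \<in> P" "a\<^sup>2 \<le> gam (a, b)" "a ^ 3 * gam (a, b) \<le> 2"
    using assms by (auto simp: P3_alt)
  show "1 < a"
    using *(1) by (simp add: P_def)
  show "0 \<le> gam (a, b)"
    using *(2) zero_le_power2[of a] by linarith
  then have "a\<^sup>2 * gam (a, b) \<le> a ^ 3 * gam (a, b)"
    using \<open>1 < a\<close> by (intro mult_right_mono power_increasing) auto
  then show "a\<^sup>2 * gam (a, b) \<le> 2"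
    using *(3) by simp
qed

lemma renormalized_parameters_in_P:
  assumes "(a, b) \<in> P3"
  shows "H_Delta (a, b) \<in> P" "H_Pi (a, b) \<in> P"
proof -
  define g where "g = gam (a, b)"
  note bounds = P3_bounds[OF assms, folded g_def]
  have "a\<^sup>2 * a\<^sup>2 \<le> a\<^sup>2 * g"
    using bounds(3) by (intro mult_left_mono) auto
  then have "a ^ 4 \<le> 2"
    using bounds(6) by (simp flip: power_add)
  moreover have "a ^ 4 * (g / a\<^sup>2) = a\<^sup>2 * g" "a ^ 4 * (g / a) = a ^ 3 * g"
    using bounds(2) by (simp_all add: eval_nat_numeral)
  moreover have "1 < a ^ 4"
    using bounds(2) by simp
  moreover have "a \<le> a\<^sup>2"
    using bounds(2) by (simp add: power2_eq_square)
  moreover have "g / a\<^sup>2 \<le> g / a" "g / a \<le> g"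
  proof -
    have "1 * g \<le> a * g"
      using bounds by (intro mult_right_mono) auto
    then show "g / a\<^sup>2 \<le> g / a" "g / a \<le> g"
      using bounds(2) by (auto simp: field_simps power2_eq_square)
  qed
  moreover have "g \<le> 2"
  proof -
    have "1 * g \<le> a\<^sup>2 * g"
      using bounds by (intro mult_right_mono) auto
    then show ?thesis
      using bounds(6) by simp
  qed
  moreover have "1 \<le> g / a\<^sup>2"
    using bounds by simp
  ultimately show "H_Delta (a, b) \<in> P" "H_Pi (a, b) \<in> P"
    using bounds by (auto simp: P_def H_Delta_def H_Pi_def g_def[symmetric])
qed

lemma funpow_2_3_4:
  "(f ^^ 2) z = f (f z)" "(f ^^ 3) z = f (f (f z))" "(f ^^ 4) z = f (f (f (f z)))"
  by (simp_all add: numeral_eq_Suc)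

lemma renormalization_on_Pi:
  assumes "(a, b) \<in> P3"
  shows "restrictive_domain T (Psi (a, b)) 4 (Pi_dom (a, b))
    \<and> affinely_conjugate (Psi (a, b) ^^ 4) (Pi_dom (a, b)) (Psi (H_Pi (a, b))) T"
proof (rule renormalization_if_orbits[where \<sigma> = "- 1"])
  note bounds = P3_bounds[OF assms]
  show "(a, b) \<in> P" "0 \<le> gam (a, b)"
    by (fact bounds)+
  show "Pi_dom (a, b) = {p. (- fst (phi (a, b) p), - 1 * snd (phi (a, b) p)) \<in> T}"
    by (auto simp: Pi_dom_def Omega_Pi)
  show "Psi (H_Pi (a, b)) ` T \<subseteq> T"
    using renormalized_parameters_in_P[OF assms] by (intro Psi_maps_T)
  let ?F = "fold_rot a (gam (a, b))"
  have orbit: "\<exists>y' w u v. ?F (- x, - y) = (a * y', w) \<and>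
      (?F ^^ 2) (- x, - y) = (a\<^sup>2 * u, a\<^sup>2 * v) \<and> (?F ^^ 3) (- x, - y) = (- (a ^ 3 * v), a ^ 3 * u) \<and>
      (?F ^^ 4) (- x, - y) = - Psi (H_Pi (a, b)) (x, y) \<and> 0 \<le> y' \<and> 0 \<le> u \<and> 0 \<le> v"
    if T: "(x, y) \<in> T" for x y
  proof -
    obtain u v where uv: "fold_diagonal (gam (a, b) / a) (fold_vertical (x, y)) = (u, v)"
      by force
    note orb = orbit_of_Pi[OF bounds(2-4) T uv]
    have "Psi (H_Pi (a, b)) (x, y) = (a ^ 4 * u, a ^ 4 * v)"
      by (simp add: H_Pi_def Psi_eq_fold uv)
    then show ?thesis
      using orb
      by (intro exI[of _ y] exI[of _ "- (a * (1 - \<bar>x - 1\<bar>))"] exI[of _ u] exI[of _ v])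
         (simp add: funpow_2_3_4)
  qed
  show "(?F ^^ 4) (- fst q, - 1 * snd q) =
      (- fst (Psi (H_Pi (a, b)) q), - 1 * snd (Psi (H_Pi (a, b)) q))" if "q \<in> T" for q
    using orbit[of "fst q" "snd q"] that by (auto simp: prod_eq_iff)
  fix j :: nat assume j: "j \<in> {1, 2, 3}"
  \<comment> \<open>The first iterate lies in \<open>X \<ge> 0\<close>, the next two in \<open>Y \<ge> 0\<close>, and \<open>\<Pi>\<close> in \<open>X \<le> 0\<close>, \<open>Y \<le> 0\<close>.\<close>
  define n :: "real \<times> real" where "n = (if j = 1 then (1, 0) else (0, 1))"
  have "n \<noteq> 0"
    by (simp add: n_def zero_prod_def)
  moreover have "n \<bullet> (- x, - y) \<le> 0 \<and> 0 \<le> n \<bullet> (?F ^^ j) (- x, - y)" if xy: "(x, y) \<in> T" for x y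
  proof -
    obtain y' w u v where orb: "?F (- x, - y) = (a * y', w)" "(?F ^^ 2) (- x, - y) = (a\<^sup>2 * u, a\<^sup>2 * v)"
      "(?F ^^ 3) (- x, - y) = (- (a ^ 3 * v), a ^ 3 * u)" "0 \<le> y'" "0 \<le> u" "0 \<le> v"
      using orbit[OF xy] by blast
    have nonneg: "0 \<le> x" "0 \<le> y"
      using xy by (auto simp: T_eq)
    from j consider "j = 1" | "j = 2" | "j = 3" by blast
    then show ?thesis
      using nonneg orb bounds(2) by cases (simp_all add: n_def)
  qed
  ultimately show "\<exists>n. n \<noteq> 0 \<and> (\<forall>q\<in>T. n \<bullet> (- fst q, - 1 * snd q) \<le> 0 \<and>
      0 \<le> n \<bullet> (?F ^^ j) (- fst q, - 1 * snd q))"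
    by (intro exI[of _ n]) auto
qed auto

lemma Delta_dom_eq:
  assumes "(a, b) \<in> P3"
  shows "Delta_dom (a, b) = {p. (- fst (phi (a, b) p), 1 * snd (phi (a, b) p))
           \<in> Psi (H_Delta (a, b)) ` T}"
    and "Psi (H_Delta (a, b)) ` T =
      {(x, y). 0 \<le> y \<and> y \<le> x \<and> x \<le> a ^ 4 \<and> x + y \<le> a\<^sup>2 * gam (a, b)}"
proof -
  define g where "g = gam (a, b)"
  note bounds = P3_bounds[OF assms, folded g_def]
  have a4: "a ^ 4 = a\<^sup>2 * a\<^sup>2"
    by (simp flip: power_add)
  have "a ^ 4 * (g / a\<^sup>2) = a\<^sup>2 * g"
    using bounds(2) by (simp add: eval_nat_numeral)
  then show E: "Psi (H_Delta (a, b)) ` T =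
      {(x, y). 0 \<le> y \<and> y \<le> x \<and> x \<le> a ^ 4 \<and> x + y \<le> a\<^sup>2 * gam (a, b)}"
    using bounds Psi_image_T[of "a ^ 4" "g / a\<^sup>2"] by (simp add: H_Delta_def g_def)
  have "a\<^sup>2 * g \<le> 2 * a ^ 4" "a ^ 4 \<le> a\<^sup>2 * g"
  proof -
    show "a ^ 4 \<le> a\<^sup>2 * g"
      unfolding a4 using bounds(3) by (intro mult_left_mono) auto
    have "1 \<le> a ^ 4"
      using bounds(2) by simp
    then show "a\<^sup>2 * g \<le> 2 * a ^ 4"
      using bounds(6) by simp
  qed
  then have "Omega [(0, 0), (- (a\<^sup>2 * g / 2), a\<^sup>2 * g / 2), (- (a ^ 4), a\<^sup>2 * g - a ^ 4), (- (a ^ 4), 0)] =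
    {(X, Y). 0 \<le> Y \<and> Y \<le> - X \<and> - X \<le> a ^ 4 \<and> - X + Y \<le> a\<^sup>2 * g}"
    by (intro Omega_Delta) auto
  then show "Delta_dom (a, b) = {p. (- fst (phi (a, b) p), 1 * snd (phi (a, b) p))
           \<in> Psi (H_Delta (a, b)) ` T}"
    unfolding E Delta_dom_def by (auto simp: g_def)
qed

lemma renormalization_on_Delta:
  assumes "(a, b) \<in> P3"
  shows "restrictive_domain T (Psi (a, b)) 4 (Delta_dom (a, b))
    \<and> affinely_conjugate (Psi (a, b) ^^ 4) (Delta_dom (a, b))
        (Psi (H_Delta (a, b))) (Psi (H_Delta (a, b)) ` T)"
proof (rule renormalization_if_orbits[where \<sigma> = 1])
  note bounds = P3_bounds[OF assms]
  define E where "E = Psi (H_Delta (a, b)) ` T"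
  show "(a, b) \<in> P" "0 \<le> gam (a, b)"
    by (fact bounds)+
  show "Delta_dom (a, b) = {p. (- fst (phi (a, b) p), 1 * snd (phi (a, b) p))
      \<in> Psi (H_Delta (a, b)) ` T}"
    by (fact Delta_dom_eq[OF assms])
  show E_T: "Psi (H_Delta (a, b)) ` T \<subseteq> T"
    using renormalized_parameters_in_P[OF assms] by (intro Psi_maps_T)
  then show "Psi (H_Delta (a, b)) ` (Psi (H_Delta (a, b)) ` T) \<subseteq> Psi (H_Delta (a, b)) ` T"
    by (rule image_mono)
  let ?F = "fold_rot a (gam (a, b))"
  have orbit: "\<exists>y' w u v. ?F (- x, y) = (- (a * y'), - (a * w)) \<and>
      (?F ^^ 2) (- x, y) = (a\<^sup>2 * w, - (a\<^sup>2 * y')) \<and> (?F ^^ 3) (- x, y) = (a ^ 3 * v, a ^ 3 * u) \<and>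
      (?F ^^ 4) (- x, y) = (- (a ^ 4 * u), a ^ 4 * v) \<and>
      Psi (H_Delta (a, b)) (x, y) = (a ^ 4 * u, a ^ 4 * v) \<and> 0 \<le> y' \<and> 0 \<le> w \<and> 0 \<le> v"
    if E: "(x, y) \<in> E" for x y
  proof -
    have T: "(x, y) \<in> T" and xy: "x + y \<le> a\<^sup>2 * gam (a, b)"
      using E E_T Delta_dom_eq(2)[OF assms] by (auto simp: E_def)
    obtain u v where uv: "fold_diagonal (gam (a, b) / a\<^sup>2) (fold_vertical (x, y)) = (u, v)"
      by force
    note orb = orbit_of_Delta[OF bounds(2-4) T xy uv]
    have "Psi (H_Delta (a, b)) (x, y) = (a ^ 4 * u, a ^ 4 * v)"
      by (simp add: H_Delta_def Psi_eq_fold uv)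
    then show ?thesis
      using orb
      by (intro exI[of _ y] exI[of _ "1 - \<bar>x - 1\<bar>"] exI[of _ u] exI[of _ v])
         (simp add: funpow_2_3_4)
  qed
  show "(?F ^^ 4) (- fst q, 1 * snd q) =
      (- fst (Psi (H_Delta (a, b)) q), 1 * snd (Psi (H_Delta (a, b)) q))"
    if "q \<in> Psi (H_Delta (a, b)) ` T" for q
    using orbit[of "fst q" "snd q"] that by (auto simp: E_def)
  fix j :: nat assume j: "j \<in> {1, 2, 3}"
  \<comment> \<open>The first iterate lies in \<open>Y \<le> 0\<close>, the next two in \<open>X \<ge> 0\<close>, and \<open>\<Delta>\<close> in \<open>X \<le> 0\<close>, \<open>Y \<ge> 0\<close>.\<close>
  define n :: "real \<times> real" where "n = (if j = 1 then (0, - 1) else (1, 0))"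
  have "n \<noteq> 0"
    by (simp add: n_def zero_prod_def)
  moreover have "n \<bullet> (- x, y) \<le> 0 \<and> 0 \<le> n \<bullet> (?F ^^ j) (- x, y)" if xy: "(x, y) \<in> E" for x y
  proof -
    obtain y' w u v where orb: "?F (- x, y) = (- (a * y'), - (a * w))"
      "(?F ^^ 2) (- x, y) = (a\<^sup>2 * w, - (a\<^sup>2 * y'))"
      "(?F ^^ 3) (- x, y) = (a ^ 3 * v, a ^ 3 * u)" "0 \<le> y'" "0 \<le> w" "0 \<le> v"
      using orbit[OF xy] by blast
    have nonneg: "0 \<le> x" "0 \<le> y"
      using xy E_T by (auto simp: T_eq E_def)
    from j consider "j = 1" | "j = 2" | "j = 3" by blast
    then show ?thesis
      using nonneg orb bounds(2) by cases (simp_all add: n_def)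
  qed
  ultimately show "\<exists>n. n \<noteq> 0 \<and> (\<forall>q\<in>Psi (H_Delta (a, b)) ` T. n \<bullet> (- fst q, 1 * snd q) \<le> 0 \<and>
      0 \<le> n \<bullet> (?F ^^ j) (- fst q, 1 * snd q))"
    by (intro exI[of _ n]) (auto simp: E_def)
qed auto

lemma Delta_dom_neq_Pi_dom:
  assumes "(a, b) \<in> P3"
  shows "Delta_dom (a, b) \<noteq> Pi_dom (a, b)"
proof -
  define x0 y0 s where "x0 = fst (fixed_pt (a, b))" and "y0 = snd (fixed_pt (a, b))"
    and "s = x0 - 1"
  have "0 < s"
    using fixed_pt_relations(3)[OF P3_bounds(1)[OF assms]] by (simp add: s_def x0_def)
  then have phi: "phi (a, b) (x0 - s, y0 - s) = (- 1, - 1)"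
    by (simp add: phi_def x0_def[symmetric] y0_def[symmetric] s_def[symmetric])
  \<comment> \<open>The vertex \<open>(-1, -1)\<close> of \<open>\<Pi>\<close> has a negative second coordinate, which no point of \<open>\<Delta>\<close> has.\<close>
  have "(x0 - s, y0 - s) \<in> Pi_dom (a, b)"
    by (simp add: Pi_dom_def phi Omega_Pi T_eq)
  moreover have "(x0 - s, y0 - s) \<notin> Delta_dom (a, b)"
    unfolding Delta_dom_eq(1)[OF assms] Delta_dom_eq(2)[OF assms] by (simp add: phi)
  ultimately show ?thesis by blast
qed

theorem theorem1:
  fixes a b :: real
  assumes "(a, b) \<in> P3"
  shows "restrictive_domain T (Psi (a, b)) 4 (Delta_dom (a, b))
    \<and> restrictive_domain T (Psi (a, b)) 4 (Pi_dom (a, b))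
    \<and> Delta_dom (a, b) \<noteq> Pi_dom (a, b)
    \<and> H_Delta (a, b) \<in> P \<and> H_Pi (a, b) \<in> P
    \<and> affinely_conjugate (Psi (a, b) ^^ 4) (Delta_dom (a, b))
        (Psi (H_Delta (a, b))) (Psi (H_Delta (a, b)) ` T)
    \<and> affinely_conjugate (Psi (a, b) ^^ 4) (Pi_dom (a, b)) (Psi (H_Pi (a, b))) T"
  using renormalization_on_Delta[OF assms] renormalization_on_Pi[OF assms]
    Delta_dom_neq_Pi_dom[OF assms] renormalized_parameters_in_P[OF assms]
  by blast

end
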